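(* Work in the Poincaré disc model of the hyperbolic plane, with open unit disc $D$ centred at $\mathrm{O}$. Let $p,q$ be positive integers for which a regular convex hyperbolic polygon with $p$ sides and interior angle $\frac{2\pi}{q}$ exists, and let $P_{p,q}$ denote such a polygon having one of its vertices at $\mathrm{O}$. Let $\Gamma_{p,q}$ be the circumscribed circle of $P_{p,q}$, positioned so that the tangent to $\Gamma_{p,q}$ at $\mathrm{O}$ is horizontal. Let $h_{p,q}$ be the Euclidean distance from $\mathrm{O}$ to the hyperbolic centre of $\Gamma_{p,q}$, and let $e_{p,q}$ be the Euclidean distance from $\mathrm{O}$ to the Euclidean centre of $\Gamma_{p,q}$. Then $$h_{p,q}=\frac{\cos\left(\frac{\pi}{q}+\frac{\pi}{p}\right)}{\sqrt{\cos^2\frac{\pi}{q}-\sin^2\frac{\pi}{p}}}$$ and $$e_{p,q}=\frac{\cos\left(\frac{\pi}{q}+\frac{\pi}{p}\right)\sqrt{\cos^2\frac{\pi}{q}-\sin^2\frac{\pi}{p}}}{\cos^2\frac{\pi}{q}-\sin^2\frac{\pi}{p}+\cos^2\left(\frac{\pi}{q}+\frac{\pi}{p}\right)}.$$ Moreover, for every fixed $q$, $h_{p,q}\to 1$ and $e_{p,q}\to\frac12$ as $p\to\infty$.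
   Context: In the Poincaré disc model, the hyperbolic plane is the open Euclidean unit disc $D$; hyperbolic lines are diameters of $D$ and arcs of Euclidean circles orthogonal to $\partial D$. A hyperbolic circle is represented by a Euclidean circle contained in $D$, whose hyperbolic centre generally differs from its Euclidean centre. $P_{p,q}$ has interior angle $\frac{2\pi}{q}$, so that $q$ copies of it fit around a vertex. *)

theory Defs
  imports "HOL-Analysis.Analysis"
begin

text \<open>The Poincare disc model; the complex plane carries its Euclidean structure,
  with inner product \<open>u \<bullet> w = Re u * Re w + Im u * Im w\<close>.\<close>

abbreviation disc :: "complex set" where
  "disc \<equiv> ball 0 1"

definition hdist :: "complex \<Rightarrow> complex \<Rightarrow> real" where
  "hdist z w = arcosh (1 + 2 * (dist z w)\<^sup>2 / ((1 - (norm z)\<^sup>2) * (1 - (norm w)\<^sup>2)))"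

text \<open>The circle with centre \<open>c\<close> and radius \<open>r\<close> meets the boundary of the disc, and at each
  common point the radii \<open>z\<close> and \<open>z - c\<close> of the two circles are perpendicular.\<close>

definition orth_to_boundary :: "complex \<Rightarrow> real \<Rightarrow> bool" where
  "orth_to_boundary c r \<longleftrightarrow> r > 0 \<and> sphere 0 1 \<inter> sphere c r \<noteq> {} \<and>
     (\<forall>z \<in> sphere 0 1 \<inter> sphere c r. orthogonal z (z - c))"

definition diameter_line :: "complex \<Rightarrow> complex set" where
  "diameter_line n = {z \<in> disc. orthogonal n z}"

definition arc_line :: "complex \<Rightarrow> real \<Rightarrow> complex set" where
  "arc_line c r = disc \<inter> sphere c r"

definition hyp_line :: "complex set \<Rightarrow> bool" where
  "hyp_line L \<longleftrightarrow> (\<exists>n. n \<noteq> 0 \<and> L = diameter_line n) \<or>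
     (\<exists>c r. orth_to_boundary c r \<and> L = arc_line c r)"

text \<open>\<open>u\<close> is a Euclidean tangent vector at the point \<open>z\<close> of the hyperbolic line \<open>L\<close>.\<close>

definition line_tangent :: "complex set \<Rightarrow> complex \<Rightarrow> complex \<Rightarrow> bool" where
  "line_tangent L z u \<longleftrightarrow> (\<exists>n. n \<noteq> 0 \<and> L = diameter_line n \<and> orthogonal n u) \<or>
     (\<exists>c r. orth_to_boundary c r \<and> L = arc_line c r \<and> orthogonal (z - c) u)"

text \<open>\<open>u\<close> is the unit tangent vector at \<open>z\<close> of the hyperbolic segment from \<open>z\<close> to \<open>w\<close>.
  An arc that represents a hyperbolic line is shorter than a semicircle, so of the two unit
  tangent vectors at \<open>z\<close> the one pointing along the arc towards \<open>w\<close> is the one with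
  \<open>u \<bullet> (w - z) > 0\<close>.\<close>

definition unit_tangent :: "complex \<Rightarrow> complex \<Rightarrow> complex \<Rightarrow> bool" where
  "unit_tangent z w u \<longleftrightarrow>
     (\<exists>L. hyp_line L \<and> z \<in> L \<and> w \<in> L \<and> line_tangent L z u) \<and> norm u = 1 \<and> u \<bullet> (w - z) > 0"

text \<open>\<open>\<alpha>\<close> (between 0 and \<open>pi\<close>) is the angle at \<open>z\<close> between the hyperbolic segments from \<open>z\<close>
  to \<open>a\<close> and from \<open>z\<close> to \<open>b\<close>; the model is conformal, so this is the Euclidean angle.\<close>

definition has_hyp_angle :: "complex \<Rightarrow> complex \<Rightarrow> complex \<Rightarrow> real \<Rightarrow> bool" where
  "has_hyp_angle a z b \<alpha> \<longleftrightarrow>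
     (\<exists>u w. unit_tangent z a u \<and> unit_tangent z b w \<and> \<alpha> = arccos (u \<bullet> w))"

text \<open>A polygon with \<open>p\<close> sides is given by its vertices \<open>v 0, \<dots>, v (p - 1)\<close> in cyclic order,
  the sides joining \<open>v i\<close> to \<open>v ((i + 1) mod p)\<close>. It is convex if for every side the remaining
  vertices all lie in one open half-plane bounded by the line through that side. The open
  half-planes bounded by \<open>L\<close> are the connected components of \<open>disc - L\<close>.\<close>

definition convex_hyp_polygon :: "nat \<Rightarrow> (nat \<Rightarrow> complex) \<Rightarrow> bool" where
  "convex_hyp_polygon p v \<longleftrightarrow> p \<ge> 3 \<and> v ` {..<p} \<subseteq> disc \<and> inj_on v {..<p} \<and>
     (\<forall>i<p. \<exists>L H. hyp_line L \<and> v i \<in> L \<and> v ((i + 1) mod p) \<in> L \<and> H \<in> components (disc - L) \<and>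
        (\<forall>j<p. j \<noteq> i \<and> j \<noteq> (i + 1) mod p \<longrightarrow> v j \<in> H))"

text \<open>Regular convex polygon with interior angle \<open>2 * pi / q\<close>. In a convex polygon the interior
  angle is the angle between the two sides at the vertex.\<close>

definition regular_hyp_polygon :: "nat \<Rightarrow> nat \<Rightarrow> (nat \<Rightarrow> complex) \<Rightarrow> bool" where
  "regular_hyp_polygon p q v \<longleftrightarrow> q > 0 \<and> convex_hyp_polygon p v \<and>
     (\<exists>s. \<forall>i<p. hdist (v i) (v ((i + 1) mod p)) = s) \<and>
     (\<forall>i<p. has_hyp_angle (v i) (v ((i + 1) mod p)) (v ((i + 2) mod p)) (2 * pi / real q))"

definition hyp_centre :: "complex set \<Rightarrow> complex \<Rightarrow> bool" where
  "hyp_centre \<Gamma> c \<longleftrightarrow> c \<in> disc \<and> (\<exists>R>0. \<Gamma> = {z \<in> disc. hdist c z = R})"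

definition euclidean_centre :: "complex set \<Rightarrow> complex \<Rightarrow> bool" where
  "euclidean_centre \<Gamma> m \<longleftrightarrow> (\<exists>r>0. \<Gamma> = sphere m r)"

text \<open>\<open>v\<close> is a regular polygon with a vertex at the origin, and \<open>\<Gamma>\<close> is its circumscribed circle,
  with hyperbolic centre \<open>c\<close> and Euclidean centre \<open>m\<close>. The last conjunct says that the tangent
  to \<open>\<Gamma>\<close> at the origin is horizontal: the radius vector \<open>0 - m\<close> is perpendicular to the
  horizontal direction \<open>1\<close>.\<close>

definition positioned_polygon ::
  "nat \<Rightarrow> nat \<Rightarrow> (nat \<Rightarrow> complex) \<Rightarrow> complex set \<Rightarrow> complex \<Rightarrow> complex \<Rightarrow> bool" where
  "positioned_polygon p q v \<Gamma> c m \<longleftrightarrow> regular_hyp_polygon p q v \<and> 0 \<in> v ` {..<p} \<and>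
     v ` {..<p} \<subseteq> \<Gamma> \<and> hyp_centre \<Gamma> c \<and> euclidean_centre \<Gamma> m \<and> orthogonal (0 - m) 1"

end

theory Submission
  imports Defs
begin

text \<open>The half-turn exchanging \<open>0\<close> and the hyperbolic centre \<open>c\<close> carries the circumscribed circle to
  the Euclidean circle about \<open>0\<close> through \<open>c\<close>; after division by \<open>c\<close> the vertices are the points \<open>\<omega> ^ j\<close>
  of the unit circle, because equal sides give equal chords and distinct vertices
  forbid a chord to be traced back. Convexity excludes the star polygons, so that
  \<open>Re \<omega> = cos (2 * pi / p)\<close>. Hyperbolic lines through \<open>0\<close> are diameters, so the interior angle at the vertex
  \<open>0\<close> is the Euclidean angle between its two neighbours. With \<open>A = pi / p\<close>, \<open>B = pi / q\<close>
  this angle condition becomes \<open>cos (A + B) = (norm c)\<^sup>2 * cos (A - B)\<close>, and the Euclidean centre is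
  \<open>c / (1 + (norm c)\<^sup>2)\<close>.

  For the limits, the relation at a single \<open>p\<close> forces \<open>B < pi / 2\<close>, and then for all large \<open>p\<close> the points
  \<open>\<rho> * cis (2 * j * A)\<close> with \<open>\<rho>\<^sup>2 = cos (A + B) / cos (A - B)\<close> form a regular polygon with the
  prescribed angle.\<close>

section \<open>Circles orthogonal to the boundary; lines and angles at the origin\<close>

text \<open>Pythagoras in the triangle \<open>0\<close>, \<open>z\<close>, \<open>c\<close>, whose
  right angle is at a common point \<open>z\<close> of the two circles.\<close>

lemma norm_sq_orth_circle:
  assumes "orth_to_boundary c r"
  shows "(norm c)\<^sup>2 = 1 + r\<^sup>2"
proof -
  obtain z where z: "norm z = 1" "dist c z = r" "orthogonal z (z - c)"
    using assms unfolding orth_to_boundary_def by (metis IntE ex_in_conv mem_sphere_0 mem_sphere)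
  have "(norm (z - (z - c)))\<^sup>2 = (norm z)\<^sup>2 + (norm (z - c))\<^sup>2"
    using z(3) by (simp add: power2_norm_eq_inner orthogonal_def inner_commute algebra_simps)
  then show ?thesis using z by (simp add: dist_norm norm_minus_commute)
qed

text \<open>Converse of \<open>norm_sq_orth_circle\<close>; since the definition demands a common
  point, one has to be exhibited.\<close>

lemma orth_to_boundaryI:
  assumes "r > 0" and c: "(norm c)\<^sup>2 = 1 + r\<^sup>2"
  shows "orth_to_boundary c r"
  unfolding orth_to_boundary_def
proof (intro conjI ballI)
  show "r > 0" by fact
  have c0: "c \<noteq> 0" using c by (auto simp: add_nonneg_eq_0_iff)
  have "(norm (Complex 1 r))\<^sup>2 = (norm c)\<^sup>2" using c by (simp add: cmod_power2)
  then have n1: "norm (Complex 1 r) = norm c" by simp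
  \<comment> \<open>This is \<open>c / (1 - \<i> * r)\<close>, the point where a tangent from
    \<open>c\<close> touches the unit circle.\<close>
  define z where "z = c * Complex 1 r / of_real ((norm c)\<^sup>2)"
  have "norm z = 1"
    using c0 by (simp add: z_def norm_mult norm_divide n1 power2_eq_square)
  moreover have "z - c = c * (\<i> * of_real r * Complex 1 r) / of_real ((norm c)\<^sup>2)"
  proof -
    have "(of_real ((norm c)\<^sup>2) :: complex) \<noteq> 0" using c0 by simp
    moreover have "Complex 1 r - of_real ((norm c)\<^sup>2) = \<i> * of_real r * Complex 1 r"
      unfolding c by (simp add: complex_eq_iff power2_eq_square)
    ultimately show ?thesis unfolding z_def
      by (metis (no_types, lifting) diff_divide_distrib nonzero_mult_div_cancel_right right_diff_distrib)
  qed
  then have "norm (z - c) = r"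
    using c0 assms(1) by (simp add: norm_mult norm_divide n1 power2_eq_square)
  ultimately show "sphere 0 1 \<inter> sphere c r \<noteq> {}"
    by (auto simp: dist_norm norm_minus_commute)
next
  fix z assume "z \<in> sphere 0 1 \<inter> sphere c r"
  then have z: "norm z = 1" "norm (c - z) = r" by (auto simp: dist_norm)
  have "(norm (c - z))\<^sup>2 = (norm c)\<^sup>2 + (norm z)\<^sup>2 - 2 * (z \<bullet> c)"
    by (simp add: power2_norm_eq_inner inner_commute algebra_simps)
  then have "z \<bullet> c = 1" using z c by simp
  then show "orthogonal z (z - c)"
    using z by (simp add: orthogonal_def inner_diff_right dot_square_norm)
qed

text \<open>A circle through \<open>0\<close> has \<open>norm c = r\<close>, which contradicts
  \<open>(norm c)\<^sup>2 = 1 + r\<^sup>2\<close>, so only diameters remain.\<close>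

lemma hyp_line_through_origin:
  assumes "line_tangent L z u \<or> hyp_line L" "0 \<in> L"
  obtains n where "n \<noteq> 0" "L = diameter_line n" "line_tangent L z u \<Longrightarrow> orthogonal n u"
proof -
  have "\<not> (orth_to_boundary c r \<and> L = arc_line c r)" for c r
    using assms(2) norm_sq_orth_circle[of c r] by (auto simp: arc_line_def)
  then show thesis using that assms(1) unfolding line_tangent_def hyp_line_def by blast
qed

text \<open>In the plane, \<open>u\<close> and \<open>a\<close> are both orthogonal to
  \<open>n \<noteq> 0\<close>, hence parallel; the sign condition on \<open>u \<bullet> a\<close>
  selects the direction of \<open>a\<close>.\<close>

lemma unit_tangent_origin:
  assumes "unit_tangent 0 a u"
  shows "u = sgn a"
proof -
  obtain L where L: "0 \<in> L" "a \<in> L" "line_tangent L 0 u" and u: "norm u = 1" "u \<bullet> a > 0"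
    using assms by (auto simp: unit_tangent_def)
  obtain n where n: "n \<noteq> 0" "L = diameter_line n" "orthogonal n u"
    using hyp_line_through_origin[of L 0 u] L by metis
  have na: "n \<bullet> a = 0" "n \<bullet> u = 0" using n L(2) by (auto simp: diameter_line_def orthogonal_def)
  have "Re n * (Re a * Im u - Im a * Re u) = 0" "Im n * (Re a * Im u - Im a * Re u) = 0"
    using na unfolding inner_complex_def by algebra+
  then have "Re a * Im u - Im a * Re u = 0" using n(1) by (auto simp: complex_eq_iff)
  then have "(u \<bullet> a)\<^sup>2 = (norm u * norm a)\<^sup>2"
    unfolding power_mult_distrib cmod_power2 inner_complex_def by algebra
  then have "u \<bullet> a = norm u * norm a" using u by (simp add: power2_eq_iff_nonneg less_imp_le)
  then have "norm u *\<^sub>R a = norm a *\<^sub>R u" by (simp add: norm_cauchy_schwarz_eq)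
  moreover have "a \<noteq> 0" using u by auto
  ultimately show ?thesis using u(1) by (simp add: sgn_div_norm divideR_right)
qed

text \<open>The bound by \<open>pi\<close> holds because the angle is a value of
  \<open>arccos\<close>; applied to \<open>2 * pi / q\<close> it excludes
  \<open>q = 1\<close>.\<close>

lemma has_hyp_angle_origin:
  assumes "has_hyp_angle a 0 b \<alpha>"
  shows "cos \<alpha> = sgn a \<bullet> sgn b" "\<alpha> \<le> pi"
proof -
  have \<alpha>: "\<alpha> = arccos (sgn a \<bullet> sgn b)"
    using assms by (auto simp: has_hyp_angle_def dest!: unit_tangent_origin)
  have "\<bar>sgn a \<bullet> sgn b\<bar> \<le> norm (sgn a) * norm (sgn b)" by (rule Cauchy_Schwarz_ineq2)
  also have "\<dots> \<le> 1" by (simp add: norm_sgn)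
  finally have "\<bar>sgn a \<bullet> sgn b\<bar> \<le> 1" .
  then show "cos \<alpha> = sgn a \<bullet> sgn b" "\<alpha> \<le> pi"
    unfolding \<alpha> by (simp_all add: cos_arccos_abs arccos_ubound abs_le_iff)
qed

text \<open>The linear form \<open>n\<close> maps the connected set \<open>H\<close> to an interval
  that misses 0.\<close>

lemma component_one_side:
  assumes "H \<in> components (disc - diameter_line n)" "x \<in> H" "y \<in> H"
  shows "(n \<bullet> x) * (n \<bullet> y) > 0"
proof -
  have conn: "connected H" and sub: "H \<subseteq> disc - diameter_line n"
    using assms(1) in_components_connected in_components_subset by blast+
  have nz: "n \<bullet> z \<noteq> 0" if "z \<in> H" for z
    using that sub by (auto simp: diameter_line_def orthogonal_def)
  have "connected ((\<lambda>z. n \<bullet> z) ` H)"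
    by (intro connected_continuous_image conn continuous_intros)
  then have int: "is_interval ((\<lambda>z. n \<bullet> z) ` H)" by (simp add: is_interval_connected_1)
  show ?thesis
  proof (rule ccontr)
    assume "\<not> ?thesis"
    then have "(n \<bullet> x \<le> 0 \<and> 0 \<le> n \<bullet> y) \<or> (n \<bullet> y \<le> 0 \<and> 0 \<le> n \<bullet> x)"
      by (auto simp: not_less mult_le_0_iff)
    then have "0 \<in> (\<lambda>z. n \<bullet> z) ` H"
      using mem_is_interval_1_I[OF int] assms(2,3) by blast
    then show False using nz by auto
  qed
qed

section \<open>Hyperbolic distance and the half-turn exchanging 0 and \<open>c\<close>\<close>

text \<open>\<open>cosh\<close> undoes \<open>arcosh\<close>, because inside the disc the argument
  of \<open>arcosh\<close> is at least 1.\<close>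

lemma hdist_eqD:
  assumes "z \<in> disc" "w \<in> disc" "z' \<in> disc" "w' \<in> disc" "hdist z w = hdist z' w'"
  shows "(dist z w)\<^sup>2 / ((1 - (norm z)\<^sup>2) * (1 - (norm w)\<^sup>2)) =
    (dist z' w')\<^sup>2 / ((1 - (norm z')\<^sup>2) * (1 - (norm w')\<^sup>2))"
proof -
  have "1 + 2 * (dist z w)\<^sup>2 / ((1 - (norm z)\<^sup>2) * (1 - (norm w)\<^sup>2)) \<ge> 1"
    if "z \<in> disc" "w \<in> disc" for z w :: complex
    using that by (auto intro!: divide_nonneg_nonneg mult_nonneg_nonneg simp: abs_square_le_1)
  from cosh_arcosh_real[OF this] have "cosh (hdist z w) = 
     1 + 2 * (dist z w)\<^sup>2 / ((1 - (norm z)\<^sup>2) * (1 - (norm w)\<^sup>2))"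
    if "z \<in> disc" "w \<in> disc" for z w :: complex using that by (simp add: hdist_def)
  from this[OF assms(1,2)] this[OF assms(3,4)] assms(5) show ?thesis by simp
qed

lemma one_minus_cnj_nonzero:
  assumes "norm c < 1" "norm z < 1"
  shows "1 - cnj c * z \<noteq> 0"
proof
  assume "1 - cnj c * z = 0"
  then have "norm c * norm z = 1" by (metis complex_mod_cnj eq_iff_diff_eq_0 norm_mult norm_one)
  then show False using assms by (metis less_irrefl mult_strict_mono' norm_ge_zero mult_1)
qed

text \<open>The half-turn about the hyperbolic midpoint of \<open>0\<close> and \<open>c\<close>.\<close>

definition half_turn :: "complex \<Rightarrow> complex \<Rightarrow> complex" where
  "half_turn c z = (c - z) / (1 - cnj c * z)"

lemma half_turn_involution:
  assumes "norm c < 1" "norm z < 1"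
  shows "half_turn c (half_turn c z) = z"
proof -
  have nz: "1 - cnj c * z \<noteq> 0" "1 - cnj c * c \<noteq> 0"
    using one_minus_cnj_nonzero[OF assms] one_minus_cnj_nonzero[OF assms(1,1)] by auto
  have "c - half_turn c z = z * (1 - cnj c * c) / (1 - cnj c * z)"
    "1 - cnj c * half_turn c z = (1 - cnj c * c) / (1 - cnj c * z)"
    using nz by (simp_all add: half_turn_def field_simps)
  then show ?thesis using nz by (simp add: half_turn_def[of c "half_turn c z"])
qed

text \<open>For points of the disc the hypothesis is the polynomial form of
  \<open>hdist c z = hdist c 0\<close>, see \<open>hdist_eq_hdist_origin_iff\<close>. It makes the
  norm of the denominator of \<open>half_turn c z\<close> depend on \<open>norm z\<close>
  alone.\<close>

lemma norm_one_minus_cnj_sq: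
  assumes "(norm (c - z))\<^sup>2 = (norm c)\<^sup>2 * (1 - (norm z)\<^sup>2)"
  shows "(norm (1 - cnj c * z))\<^sup>2 = 1 - (norm z)\<^sup>2"
  using assms unfolding cmod_power2 by (simp add: power2_eq_square algebra_simps)

lemma norm_half_turn:
  assumes "norm c < 1" "norm z < 1" "(norm (c - z))\<^sup>2 = (norm c)\<^sup>2 * (1 - (norm z)\<^sup>2)"
  shows "norm (half_turn c z) = norm c"
proof -
  have "1 - (norm z)\<^sup>2 \<noteq> 0" using assms(2) by (metis abs_norm_cancel abs_square_eq_1 eq_iff_diff_eq_0 less_irrefl)
  then have "(norm (half_turn c z))\<^sup>2 = (norm c)\<^sup>2"
    by (simp add: half_turn_def norm_divide power_divide norm_one_minus_cnj_sq[OF assms(3)] assms(3))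
  then show ?thesis by simp
qed

text \<open>The last factor is the quotient inside \<open>hdist\<close>, so on the circle about
  \<open>c\<close> through 0 equal hyperbolic distances become equal Euclidean chords.\<close>

lemma half_turn_diff_sq:
  assumes "norm c < 1" "norm z < 1" "norm w < 1"
    "(norm (c - z))\<^sup>2 = (norm c)\<^sup>2 * (1 - (norm z)\<^sup>2)"
    "(norm (c - w))\<^sup>2 = (norm c)\<^sup>2 * (1 - (norm w)\<^sup>2)"
  shows "(norm (half_turn c z - half_turn c w))\<^sup>2 =
    (1 - (norm c)\<^sup>2)\<^sup>2 * ((dist z w)\<^sup>2 / ((1 - (norm z)\<^sup>2) * (1 - (norm w)\<^sup>2)))"
proof -
  have nz: "1 - cnj c * z \<noteq> 0" "1 - cnj c * w \<noteq> 0"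
    using one_minus_cnj_nonzero assms by auto
  have "half_turn c z - half_turn c w =
     (w - z) * (1 - cnj c * c) / ((1 - cnj c * z) * (1 - cnj c * w))"
    using nz by (simp add: half_turn_def divide_simps) (simp add: algebra_simps)
  moreover have "(norm (1 - cnj c * c))\<^sup>2 = (1 - (norm c)\<^sup>2)\<^sup>2"
  proof -
    have "1 - cnj c * c = of_real (1 - (norm c)\<^sup>2)"
      using complex_norm_square[of c] by (simp add: mult.commute)
    then show ?thesis by (simp only: norm_of_real power2_abs)
  qed
  ultimately show ?thesis
    by (simp add: norm_mult norm_divide power_mult_distrib power_divide
        norm_one_minus_cnj_sq[OF assms(4)] norm_one_minus_cnj_sq[OF assms(5)] 
        dist_norm norm_minus_commute)
qed

section \<open>Points of the unit circle and Euclidean centres\<close>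

text \<open>The quotients of successive points lie on the unit circle at a fixed distance from 1, so
  any two are equal or conjugate. Conjugate neighbouring quotients have product 1 and would give
  \<open>W (Suc (Suc j)) = W j\<close>.\<close>

lemma equal_chords_powers:
  fixes W :: "nat \<Rightarrow> complex"
  assumes "\<And>j. norm (W j) = 1" "W 0 = 1" "\<And>j. norm (W (Suc j) - W j) = s"
    and "\<And>j. W (Suc (Suc j)) \<noteq> W j"
  shows "W j = W 1 ^ j"
proof -
  define u where "u j = W (Suc j) / W j" for j
  have W0: "W j \<noteq> 0" for j using assms(1)[of j] by auto
  have nu: "norm (u j) = 1" for j by (simp add: u_def norm_divide assms(1))
  have "norm (u j - 1) = s" for j
  proof -
    have "u j - 1 = (W (Suc j) - W j) / W j" using W0[of j] by (simp add: u_def field_simps)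
    then show ?thesis by (simp add: norm_divide assms)
  qed
  then have nd: "(norm (u j - 1))\<^sup>2 = s\<^sup>2" for j by simp
  have nu2: "(norm (u j))\<^sup>2 = 1" for j by (simp add: nu)
  have Re: "Re (u j) = Re (u 0)" for j
    using nd[of j] nd[of 0] nu2[of j] nu2[of 0] unfolding cmod_power2
    by (simp add: power2_eq_square algebra_simps)
  have step: "u (Suc j) = u j" for j
  proof -
    have "Im (u (Suc j)) ^ 2 = Im (u j) ^ 2"
      using nu2[of j] nu2[of "Suc j"] Re[of j] Re[of "Suc j"] unfolding cmod_power2 by simp
    then have "u (Suc j) = u j \<or> u (Suc j) = cnj (u j)"
      using Re[of j] Re[of "Suc j"] by (auto simp: complex_eq_iff power2_eq_iff)
    moreover have "u (Suc j) * u j = W (Suc (Suc j)) / W j"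
      using W0 by (simp add: u_def)
    then have "u (Suc j) * u j \<noteq> 1" using assms(4)[of j] W0[of j] by auto
    moreover have "cnj (u j) * u j = 1"
      using complex_norm_square[of "u j"] nu by (simp add: mult.commute)
    ultimately show ?thesis by auto
  qed
  have "u j = W 1" for j by (induction j) (simp_all add: step u_def[of 0] assms(2))
  then have rec: "W (Suc j) = W 1 * W j" for j
    using W0[of j] unfolding u_def by (metis nonzero_divide_eq_eq)
  show ?thesis
  proof (induction j)
    case (Suc j)
    then show ?case by (subst rec) simp
  qed (simp add: assms(2))
qed

text \<open>Antipodal points of the second circle are equidistant from \<open>m\<close>, so every
  unit vector is orthogonal to \<open>m' - m\<close>.\<close>

lemma sphere_centre_unique:
  fixes m m' :: complex
  assumes "sphere m r = sphere m' r'" "r' > 0"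
  shows "m = m'"
proof -
  have eq: "u \<bullet> (m' - m) = 0" if "norm u = 1" for u
  proof -
    have "m' + r' *\<^sub>R u \<in> sphere m r" "m' - r' *\<^sub>R u \<in> sphere m r"
      unfolding assms(1) using that assms(2) by (auto simp: dist_norm)
    then have "(norm ((m' - m) + r' *\<^sub>R u))\<^sup>2 = (norm ((m' - m) - r' *\<^sub>R u))\<^sup>2"
      by (simp add: dist_norm norm_minus_commute algebra_simps)
    then have "r' * (u \<bullet> (m' - m)) = 0"
      by (simp add: power2_norm_eq_inner inner_commute algebra_simps)
    then show ?thesis using assms(2) by simp
  qed
  then have "Re (m' - m) = 0" "Im (m' - m) = 0" using eq[of 1] eq[of \<i>] by (simp_all add: inner_complex_def)
  then show ?thesis by (simp add: complex_eq_iff)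
qed

text \<open>Counting: \<open>p\<close> distinct powers of \<open>\<omega>\<close> exhaust the
  \<open>p\<close> roots of unity.\<close>

lemma roots_of_unity_powers:
  fixes \<omega> x :: complex
  assumes "p > 0" "inj_on (\<lambda>j. \<omega> ^ j) {..<p}" "\<omega> ^ p = 1" "x ^ p = 1"
  obtains j where "j < p" "x = \<omega> ^ j"
proof -
  have "(\<omega> ^ j) ^ p = 1" for j
    unfolding power_mult[symmetric] mult.commute[of j] unfolding power_mult assms(3) by simp
  then have sub: "(\<lambda>j. \<omega> ^ j) ` {..<p} \<subseteq> {z::complex. z ^ p = 1}" by auto
  have "card ((\<lambda>j. \<omega> ^ j) ` {..<p}) = card {z::complex. z ^ p = 1}"
    using assms(1,2) by (simp add: card_image card_roots_unity_eq)
  then have "(\<lambda>j. \<omega> ^ j) ` {..<p} = {z::complex. z ^ p = 1}"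
    using sub assms(1) by (intro card_subset_eq finite_roots_unity) auto
  then show thesis using assms(4) that by blast
qed

section \<open>Side test, vertex angle and radius in unit-circle coordinates\<close>

text \<open>With \<open>h = (norm c)\<^sup>2\<close> the half-turn of \<open>c * W\<close> is
  \<open>c * (1 - W) / (1 - h * W)\<close>. Clearing the denominator and using
  \<open>norm W = 1\<close> leaves an expression affine in \<open>Re W\<close> and
  \<open>Im W\<close>, so the side of a diameter is tested by a chord of the unit circle.\<close>

lemma side_line_form:
  fixes c n W :: complex
  assumes "norm c < 1" "norm W = 1"
  shows "n \<bullet> half_turn c (c * W) * (norm (1 - (of_real (norm c))\<^sup>2 * W))\<^sup>2 =
    (1 + (norm c)\<^sup>2) * (n \<bullet> c) * (1 - Re W) - (1 - (norm c)\<^sup>2) * (Re n * Im c - Im n * Re c) * (- Im W)"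
    (is "?l = ?r")
proof -
  define h where "h = (norm c)\<^sup>2"
  define D where "D = 1 - of_real h * W"
  have "norm (of_real h * W) < 1"
    using assms by (simp add: h_def norm_mult norm_power abs_square_less_1)
  then have D0: "D \<noteq> 0" unfolding D_def by (metis eq_iff_diff_eq_0 less_irrefl norm_one)
  have "1 - cnj c * (c * W) = D"
    using complex_norm_square[of c] by (simp add: D_def h_def mult.commute mult.left_commute)
  then have "half_turn c (c * W) = c * (1 - W) / D"
    by (simp add: half_turn_def right_diff_distrib)
  then have "half_turn c (c * W) * of_real ((norm D)\<^sup>2) = c * (1 - W) * cnj D"
    using D0 unfolding complex_norm_square by simp
  moreover have "n \<bullet> (half_turn c (c * W) * of_real ((norm D)\<^sup>2)) = n \<bullet> half_turn c (c * W) * (norm D)\<^sup>2"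
    by (simp add: inner_complex_def algebra_simps)
  ultimately have "n \<bullet> half_turn c (c * W) * (norm D)\<^sup>2 = n \<bullet> (c * (1 - W) * cnj D)" by simp
  moreover have "(norm W)\<^sup>2 = 1" using assms by simp
  then have "(Re W)\<^sup>2 + (Im W)\<^sup>2 = 1" unfolding cmod_power2 .
  then have "n \<bullet> (c * (1 - W) * cnj D) =
     (1 + h) * (n \<bullet> c) * (1 - Re W) - (1 - h) * (Re n * Im c - Im n * Re c) * (- Im W)"
    unfolding inner_complex_def D_def by simp algebra
  ultimately show ?thesis by (simp add: D_def h_def)
qed

text \<open>The form \<open>b1 * (1 - Re W) - b2 * Im W\<close> vanishes at 1 and, by assumption, at
  \<open>cis (2 * \<theta>)\<close>. The chord between these points cannot leave
  \<open>cis (2 * A)\<close> and \<open>cis (- (2 * A))\<close> strictly on one side, since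
  \<open>2 * \<theta>\<close> lies between \<open>2 * A\<close> and
  \<open>2 * pi - 2 * A\<close>.\<close>

lemma chord_form_sign:
  fixes b1 b2 \<theta> A :: real
  assumes "b1 * (1 - cos (2 * \<theta>)) = b2 * sin (2 * \<theta>)" "A \<le> \<theta>" "\<theta> \<le> pi - A" "0 < A"
  shows "(b1 * (1 - cos (2 * A)) - b2 * sin (2 * A)) * (b1 * (1 - cos (2 * A)) + b2 * sin (2 * A)) \<le> 0"
proof -
  have s: "sin \<theta> > 0" "sin (\<theta> - A) \<ge> 0" "sin (\<theta> + A) \<ge> 0"
    using assms by (auto intro!: sin_gt_zero sin_ge_zero)
  have "2 * sin \<theta> * (b1 * sin \<theta>) = 2 * sin \<theta> * (b2 * cos \<theta>)"
    using assms(1) unfolding cos_double_sin sin_double by (simp add: power2_eq_square mult_ac)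
  then have e: "b1 * sin \<theta> = b2 * cos \<theta>" using s(1) by simp
  have "(sin \<theta>)\<^sup>2 * ((b1 * (1 - cos (2 * A)) - b2 * sin (2 * A)) * (b1 * (1 - cos (2 * A)) + b2 * sin (2 * A)))
    = - (4 * (b2 * sin A)\<^sup>2 * (sin (\<theta> - A) * sin (\<theta> + A)))"
  proof -
    have "(sin \<theta>)\<^sup>2 * ((b1 * (1 - cos (2 * A)) - b2 * sin (2 * A)) * (b1 * (1 - cos (2 * A)) + b2 * sin (2 * A)))
      = 4 * (sin A)\<^sup>2 * ((b1 * sin \<theta>)\<^sup>2 * (sin A)\<^sup>2 - (b2 * sin \<theta>)\<^sup>2 * (cos A)\<^sup>2)"
      unfolding cos_double_sin sin_double by algebra
    also have "\<dots> = - (4 * (b2 * sin A)\<^sup>2 * (sin (\<theta> - A) * sin (\<theta> + A)))"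
      unfolding e sin_diff sin_add by algebra
    finally show ?thesis .
  qed
  also have "\<dots> \<le> 0" using s by simp
  finally show ?thesis using s by (simp add: mult_le_0_iff)
qed

text \<open>Up to positive factors the two neighbours of the vertex 0 are
  \<open>c * \<gamma>\<close> and \<open>c * cnj \<gamma>\<close> with
  \<open>Re \<gamma> = x\<close> and \<open>Im \<gamma> = - y\<close>, so the cosine of their angle
  is \<open>Re (\<gamma>\<^sup>2) / (norm \<gamma>)\<^sup>2\<close>.\<close>

lemma vertex_angle_at_origin:
  fixes c \<omega> :: complex
  assumes "c \<noteq> 0" "norm c < 1" "norm \<omega> = 1"
  defines "x \<equiv> (1 + (norm c)\<^sup>2) * (1 - Re \<omega>)" and "y \<equiv> (1 - (norm c)\<^sup>2) * Im \<omega>"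
  shows "(sgn (half_turn c (c * \<omega>)) \<bullet> sgn (half_turn c (c * cnj \<omega>))) * (x\<^sup>2 + y\<^sup>2) = x\<^sup>2 - y\<^sup>2"
proof -
  define h where "h = (norm c)\<^sup>2"
  have form: "sgn (half_turn c (c * W)) = sgn (c * ((1 - W) * cnj (1 - of_real h * W)))"
    if "norm W = 1" for W
  proof -
    define D where "D = 1 - of_real h * W"
    have "norm (of_real h * W) < 1"
      using assms that by (simp add: h_def norm_mult norm_power abs_square_less_1)
    then have D0: "D \<noteq> 0" unfolding D_def by (metis eq_iff_diff_eq_0 less_irrefl norm_one)
    have "1 - cnj c * (c * W) = D"
      using complex_norm_square[of c] by (simp add: D_def h_def mult.commute mult.left_commute)
    then have "half_turn c (c * W) = c * (1 - W) / D"
      by (simp add: half_turn_def right_diff_distrib)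
    then have "of_real ((norm D)\<^sup>2) * half_turn c (c * W) = c * ((1 - W) * cnj D)"
      using D0 unfolding complex_norm_square by simp
    then have "sgn (((norm D)\<^sup>2) *\<^sub>R half_turn c (c * W)) = sgn (c * ((1 - W) * cnj D))"
      by (simp only: scaleR_conv_of_real)
    then show ?thesis using D0 by (simp add: sgn_scaleR D_def)
  qed
  define \<gamma> where "\<gamma> = (1 - \<omega>) * cnj (1 - of_real h * \<omega>)"
  have s1: "sgn (half_turn c (c * \<omega>)) = sgn (c * \<gamma>)"
    using form[OF assms(3)] by (simp add: \<gamma>_def)
  have s2: "sgn (half_turn c (c * cnj \<omega>)) = sgn (c * cnj \<gamma>)"
    using form[of "cnj \<omega>"] assms(3) by (simp add: \<gamma>_def)
  have "(Re \<omega>)\<^sup>2 + (Im \<omega>)\<^sup>2 = 1" using assms(3) cmod_power2[of \<omega>] by simp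
  then have "h * (Im \<omega> * Im \<omega>) = h * (1 - Re \<omega> * Re \<omega>)" by (simp add: power2_eq_square)
  then have "Re \<gamma> = x"
    unfolding \<gamma>_def x_def h_def[symmetric] by (simp add: algebra_simps)
  moreover have "Im \<gamma> = - y"
    unfolding \<gamma>_def y_def h_def[symmetric] by (simp add: algebra_simps)
  ultimately have \<gamma>: "Re \<gamma> = x" "Im \<gamma> = - y" .
  have n: "(norm \<gamma>)\<^sup>2 = x\<^sup>2 + y\<^sup>2" unfolding cmod_power2 \<gamma> by simp
  have i: "(c * \<gamma>) \<bullet> (c * cnj \<gamma>) = (norm c)\<^sup>2 * (x\<^sup>2 - y\<^sup>2)"
    unfolding inner_complex_def cmod_power2 by (simp add: \<gamma>) algebra
  have "(sgn (c * \<gamma>) \<bullet> sgn (c * cnj \<gamma>)) * (norm \<gamma>)\<^sup>2 = x\<^sup>2 - y\<^sup>2"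
  proof (cases "\<gamma> = 0")
    case True
    then show ?thesis using n by (simp add: sum_power2_eq_zero_iff)
  next
    case False
    have "sgn (c * \<gamma>) \<bullet> sgn (c * cnj \<gamma>) =
        ((c * \<gamma>) \<bullet> (c * cnj \<gamma>)) / ((norm c)\<^sup>2 * (norm \<gamma>)\<^sup>2)"
      by (simp add: sgn_div_norm norm_mult power2_eq_square divide_inverse)
    then show ?thesis using False assms(1) unfolding i by simp
  qed
  then show ?thesis by (simp only: s1 s2 n)
qed

lemma radius_of_half_angle:
  fixes A B h :: real
  assumes "0 < A" "A < pi / 2" "0 < B" "B \<le> pi / 2" "0 < h" "h < 1"
    and "cos (2 * B) * (((1 + h) * (1 - cos (2 * A)))\<^sup>2 + ((1 - h) * sin (2 * A))\<^sup>2) =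
      ((1 + h) * (1 - cos (2 * A)))\<^sup>2 - ((1 - h) * sin (2 * A))\<^sup>2"
  shows "cos (A + B) = h * cos (A - B)"
proof -
  have pos: "sin A > 0" "cos A > 0" "sin B > 0" "cos B \<ge> 0"
    using assms by (auto intro!: sin_gt_zero cos_gt_zero cos_ge_zero)
  define X Y where "X = (1 + h) * sin A" and "Y = (1 - h) * cos A"
  have XY: "X > 0" "Y > 0" using pos assms by (auto simp: X_def Y_def)
  have "(2 * sin A)\<^sup>2 * (cos (2 * B) * (X\<^sup>2 + Y\<^sup>2)) = (2 * sin A)\<^sup>2 * (X\<^sup>2 - Y\<^sup>2)"
    using assms(7) unfolding X_def Y_def cos_double_sin[of A] sin_double[of A] by algebra
  then have "cos (2 * B) * (X\<^sup>2 + Y\<^sup>2) = X\<^sup>2 - Y\<^sup>2" using pos by simp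
  moreover have "(sin B)\<^sup>2 + (cos B)\<^sup>2 = 1" by simp
  ultimately have "(X\<^sup>2 + Y\<^sup>2) * (X * sin B)\<^sup>2 = (X\<^sup>2 + Y\<^sup>2) * (Y * cos B)\<^sup>2"
    unfolding cos_double by algebra
  moreover have "X\<^sup>2 + Y\<^sup>2 \<noteq> 0" using XY by (simp add: sum_power2_eq_zero_iff)
  ultimately have "(X * sin B)\<^sup>2 = (Y * cos B)\<^sup>2"
    using mult_left_cancel by blast
  then have "X * sin B = Y * cos B" using XY pos by (simp add: power2_eq_iff_nonneg)
  then show ?thesis unfolding X_def Y_def cos_add cos_diff by algebra
qed

section \<open>The circumscribed circle as a Euclidean circle\<close>

lemma hdist_eq_hdist_origin_iff:
  assumes "c \<in> disc" "z \<in> disc"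
  shows "hdist c z = hdist c 0 \<longleftrightarrow> (norm (c - z))\<^sup>2 = (norm c)\<^sup>2 * (1 - (norm z)\<^sup>2)"
proof -
  have nz: "1 - (norm c)\<^sup>2 \<noteq> 0" "1 - (norm z)\<^sup>2 \<noteq> 0"
    using assms abs_square_eq_1[of "norm c"] abs_square_eq_1[of "norm z"] by auto
  have eq: "2 * (dist c z)\<^sup>2 / ((1 - (norm c)\<^sup>2) * (1 - (norm z)\<^sup>2)) =
    2 * (dist c 0)\<^sup>2 / ((1 - (norm c)\<^sup>2) * (1 - (norm (0::complex))\<^sup>2)) \<longleftrightarrow>
    (norm (c - z))\<^sup>2 = (norm c)\<^sup>2 * (1 - (norm z)\<^sup>2)"
  proof -
    have "2 * a / (u * w) = 2 * b / (u * (1 - (norm (0::complex))\<^sup>2)) \<longleftrightarrow> a = b * w"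
      if "u \<noteq> 0" "w \<noteq> 0" for a b u w :: real
      using that by (simp add: field_simps)
    from this[OF nz] show ?thesis by (simp add: dist_norm)
  qed
  show ?thesis
  proof
    assume "hdist c z = hdist c 0"
    from hdist_eqD[OF assms assms(1) _ this] show "(norm (c - z))\<^sup>2 = (norm c)\<^sup>2 * (1 - (norm z)\<^sup>2)"
      using eq by simp
  next
    assume "(norm (c - z))\<^sup>2 = (norm c)\<^sup>2 * (1 - (norm z)\<^sup>2)"
    then show "hdist c z = hdist c 0" using eq unfolding hdist_def by simp
  qed
qed

text \<open>Expanded, the polynomial equation reads \<open>(1 + (norm c)\<^sup>2) * (norm z)\<^sup>2
  = 2 * (c \<bullet> z)\<close>, and completing the square gives centre and radius.\<close>

lemma hyp_circle_through_origin:
  assumes "hyp_centre \<Gamma> c" "0 \<in> \<Gamma>"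
  shows "c \<noteq> 0" "norm c < 1"
    and "z \<in> \<Gamma> \<Longrightarrow> norm z < 1 \<and> (norm (c - z))\<^sup>2 = (norm c)\<^sup>2 * (1 - (norm z)\<^sup>2)"
    and "\<Gamma> = sphere (c /\<^sub>R (1 + (norm c)\<^sup>2)) (norm c / (1 + (norm c)\<^sup>2))"
proof -
  obtain R where c: "c \<in> disc" and R: "R > 0" "\<Gamma> = {z \<in> disc. hdist c z = R}"
    using assms(1) by (auto simp: hyp_centre_def)
  have R0: "R = hdist c 0" using assms(2) R by simp
  show "c \<noteq> 0" using R(1) R0 by (auto simp: hdist_def)
  show nc: "norm c < 1" using c by simp
  have G: "\<Gamma> = {z \<in> disc. (norm (c - z))\<^sup>2 = (norm c)\<^sup>2 * (1 - (norm z)\<^sup>2)}"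
    using R(2) R0 hdist_eq_hdist_origin_iff[OF c] by auto
  show "norm z < 1 \<and> (norm (c - z))\<^sup>2 = (norm c)\<^sup>2 * (1 - (norm z)\<^sup>2)" if "z \<in> \<Gamma>"
    using that G by simp
  define h where "h = norm c"
  have h: "0 \<le> h" "h < 1" using nc by (auto simp: h_def)
  have pos: "1 + h\<^sup>2 > 0" by (simp add: add_pos_nonneg)
  have iff: "dist (c /\<^sub>R (1 + h\<^sup>2)) z = h / (1 + h\<^sup>2) \<longleftrightarrow> (norm (c - z))\<^sup>2 = h\<^sup>2 * (1 - (norm z)\<^sup>2)" for z
  proof -
    have "(norm (c /\<^sub>R (1 + h\<^sup>2) - z))\<^sup>2 - (h / (1 + h\<^sup>2))\<^sup>2 =
      (norm z)\<^sup>2 - 2 * (c \<bullet> z) / (1 + h\<^sup>2)"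
    proof -
      have "(norm (c /\<^sub>R k - z))\<^sup>2 = (norm c / k)\<^sup>2 - 2 * (c \<bullet> z) / k + (norm z)\<^sup>2" for k
        unfolding power_divide power2_norm_eq_inner
        by (simp add: inner_diff_left inner_diff_right inner_commute power2_eq_square divide_inverse)
      then show ?thesis by (simp add: h_def)
    qed
    also have "\<dots> = ((norm (c - z))\<^sup>2 - h\<^sup>2 * (1 - (norm z)\<^sup>2)) / (1 + h\<^sup>2)"
    proof -
      have "(norm (c - z))\<^sup>2 = h\<^sup>2 - 2 * (c \<bullet> z) + (norm z)\<^sup>2"
        by (simp add: h_def power2_norm_eq_inner inner_commute algebra_simps)
      then show ?thesis using pos by (simp add: field_simps)
    qed
    finally have *: "(norm (c /\<^sub>R (1 + h\<^sup>2) - z))\<^sup>2 = (h / (1 + h\<^sup>2))\<^sup>2 \<longleftrightarrow>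
        (norm (c - z))\<^sup>2 = h\<^sup>2 * (1 - (norm z)\<^sup>2)"
      using pos by (smt (verit) divide_eq_0_iff)
    have "0 \<le> h / (1 + h\<^sup>2)" using h pos by simp
    then show ?thesis unfolding *[symmetric] dist_norm by (simp add: power2_eq_iff_nonneg)
  qed
  \<comment> \<open>The hyperbolic circle is by definition a subset of the disc, so the whole
    Euclidean circle must be shown to lie there.\<close>
  have "norm z < 1" if "dist (c /\<^sub>R (1 + h\<^sup>2)) z = h / (1 + h\<^sup>2)" for z
  proof -
    have "norm z \<le> norm (c /\<^sub>R (1 + h\<^sup>2)) + dist (c /\<^sub>R (1 + h\<^sup>2)) z"
      unfolding dist_norm by (metis norm_minus_commute norm_triangle_sub)
    also have "\<dots> = 2 * h / (1 + h\<^sup>2)" unfolding that using pos by (simp add: h_def divide_inverse)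
    also have "\<dots> < 1"
    proof -
      have "0 < (1 - h)\<^sup>2" using h by simp
      then have "2 * h < 1 + h\<^sup>2" by (simp add: power2_eq_square algebra_simps)
      then show ?thesis using pos by simp
    qed
    finally show ?thesis .
  qed
  then show "\<Gamma> = sphere (c /\<^sub>R (1 + (norm c)\<^sup>2)) (norm c / (1 + (norm c)\<^sup>2))"
    unfolding G h_def[symmetric] using iff by auto
qed

section \<open>The radius relation for a given polygon\<close>

lemma positioned_polygon_radius:
  assumes "positioned_polygon p q v \<Gamma> c m"
  shows "c \<noteq> 0" "p \<ge> 3" "q > 0" "pi / p + pi / q < pi / 2"
    "cos (pi / p + pi / q) = (norm c)\<^sup>2 * cos (pi / p - pi / q)"
    "norm m = norm c / (1 + (norm c)\<^sup>2)"
proof -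
  have reg: "regular_hyp_polygon p q v" and v\<Gamma>: "v ` {..<p} \<subseteq> \<Gamma>" and c\<Gamma>: "hyp_centre \<Gamma> c"
    and m\<Gamma>: "euclidean_centre \<Gamma> m" and "0 \<in> v ` {..<p}"
    using assms by (auto simp: positioned_polygon_def)
  then obtain k where k: "k < p" "v k = 0" by auto
  have "0 \<in> \<Gamma>" using v\<Gamma> k by force
  note circ = hyp_circle_through_origin[OF c\<Gamma> this]
  show c0: "c \<noteq> 0" by (rule circ)
  have nc: "norm c < 1" by (rule circ)
  obtain s where conv: "convex_hyp_polygon p v" and q: "q > 0"
    and side: "\<And>i. i < p \<Longrightarrow> hdist (v i) (v ((i + 1) mod p)) = s"
    and ang: "\<And>i. i < p \<Longrightarrow>
      has_hyp_angle (v i) (v ((i + 1) mod p)) (v ((i + 2) mod p)) (2 * pi / real q)"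
    using reg by (auto simp: regular_hyp_polygon_def)
  have p: "p \<ge> 3" and inj: "inj_on v {..<p}"
    using conv by (auto simp: convex_hyp_polygon_def)
  show "p \<ge> 3" "q > 0" by fact+
  define h A B where "h = (norm c)\<^sup>2" and "A = pi / p" and "B = pi / q"
  have h: "0 < h" "h < 1" using c0 nc by (simp_all add: h_def abs_square_less_1)
  have A: "0 < A" "A < pi / 2" "real p * A = pi" using p by (simp_all add: A_def field_simps)
  have sA: "sin A > 0" using A by (simp add: sin_gt_zero)

  obtain r where r: "r > 0" "\<Gamma> = sphere m r"
    using m\<Gamma> by (auto simp: euclidean_centre_def)
  have "m = c /\<^sub>R (1 + (norm c)\<^sup>2)"
    using sphere_centre_unique[of "c /\<^sub>R (1 + (norm c)\<^sup>2)" _ m r] circ(4) r by simp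
  then show "norm m = norm c / (1 + (norm c)\<^sup>2)"
    by (simp add: divide_inverse)

  \<comment> \<open>The vertices are renumbered from the one at 0 and continued periodically;
    \<open>W\<close> holds their normalised images on the unit circle, with
    \<open>W 0 = 1\<close>.\<close>
  define w where "w j = v ((k + j) mod p)" for j
  define W where "W j = half_turn c (w j) / c" for j
  have idx: "(k + j) mod p < p" for j using p by simp
  have w\<Gamma>: "w j \<in> \<Gamma>" for j using v\<Gamma> idx by (auto simp: w_def)
  note wc = circ(3)[OF w\<Gamma>]
  have cW: "c * W j = half_turn c (w j)" for j using c0 by (simp add: W_def)
  have wW: "w j = half_turn c (c * W j)" for j
    unfolding cW using half_turn_involution nc wc by simp
  have nW: "norm (W j) = 1" for j
    using norm_half_turn[OF nc] wc[of j] c0 by (simp add: W_def norm_divide)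
  have w0: "w 0 = 0" using k by (simp add: w_def)
  have W0: "W 0 = 1" using c0 by (simp add: W_def w0 half_turn_def)
  have chord: "norm (W (Suc j) - W j) = norm (W (Suc 0) - W 0)" for j
  proof -
    have s: "hdist (w j) (w (Suc j)) = s" for j
      using side[OF idx[of j]] by (simp add: w_def mod_Suc_eq)
    have d: "w j \<in> disc" for j using wc by simp
    have "(norm (half_turn c (w j) - half_turn c (w (Suc j))))\<^sup>2 =
      (norm (half_turn c (w 0) - half_turn c (w (Suc 0))))\<^sup>2"
      using half_turn_diff_sq[OF nc, of "w j" "w (Suc j)"] half_turn_diff_sq[OF nc, of "w 0" "w (Suc 0)"]
        hdist_eqD[OF d d d d, of j "Suc j" 0 "Suc 0"] wc s by simp
    then have "norm (half_turn c (w j) - half_turn c (w (Suc j))) =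
      norm (half_turn c (w 0) - half_turn c (w (Suc 0)))" by simp
    then show ?thesis
      unfolding W_def diff_divide_distrib[symmetric] norm_divide by (simp add: norm_minus_commute)
  qed
  have w_eq: "w i = w j \<longleftrightarrow> (k + i) mod p = (k + j) mod p" for i j
    unfolding w_def using inj_on_eq_iff[OF inj] idx by simp
  have W_eq: "W i = W j \<longleftrightarrow> w i = w j" for i j
  proof
    assume "W i = W j"
    then have "half_turn c (c * W i) = half_turn c (c * W j)" by simp
    then show "w i = w j" by (simp only: wW[symmetric])
  qed (simp add: W_def)
  have W_ne: "W i \<noteq> W j" if "i < j" "j < i + p" for i j
  proof
    assume "W i = W j"
    then have "(k + i) mod p = (k + j) mod p" using W_eq w_eq by simp
    then have "p dvd (k + j) - (k + i)"
      using mod_eq_dvd_iff_nat[of "k + i" "k + j" p] that(1) by simp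
    then show False using that by (auto dest: dvd_imp_le)
  qed
  define \<omega> where "\<omega> = W 1"
  have "W (Suc (Suc j)) \<noteq> W j" for j
    using W_ne[of j "Suc (Suc j)"] p by simp
  then have pow: "W j = \<omega> ^ j" for j
    unfolding \<omega>_def using equal_chords_powers[where W = W] nW W0 chord by blast
  have \<omega>p: "\<omega> ^ p = 1"
  proof -
    have "W p = W 0" using W_eq w_eq by simp
    then show ?thesis using pow by simp
  qed
  have inj\<omega>: "inj_on (\<lambda>j. \<omega> ^ j) {..<p}"
  proof (rule linorder_inj_onI)
    fix i j assume "i < j" "i \<in> {..<p}" "j \<in> {..<p}"
    then show "\<omega> ^ i \<noteq> \<omega> ^ j" using W_ne[of i j] by (simp add: pow)
  qed auto

  \<comment> \<open>Convexity is applied to the side leaving the vertex 0, whose line is a diameter,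
    so that \<open>component_one_side\<close> applies.\<close>
  obtain L H where LH: "hyp_line L" "v k \<in> L" "v ((k + 1) mod p) \<in> L" "H \<in> components (disc - L)"
    "\<And>j. j < p \<Longrightarrow> j \<noteq> k \<Longrightarrow> j \<noteq> (k + 1) mod p \<Longrightarrow> v j \<in> H"
    using conv k(1) unfolding convex_hyp_polygon_def by blast
  obtain n where n: "n \<noteq> 0" "L = diameter_line n"
    using hyp_line_through_origin[of L] LH k(2) by metis
  have nw1: "n \<bullet> w 1 = 0"
    using LH(3) n by (simp add: w_def diameter_line_def orthogonal_def)
  have wH: "w j \<in> H" if "2 \<le> j" "j < p" for j
  proof -
    have "w j \<noteq> w 0" "w j \<noteq> w 1"
      using W_ne[of 0 j] W_ne[of 1 j] W_eq that by auto
    moreover have "w 0 = v k" "w 1 = v ((k + 1) mod p)" using k(1) by (simp_all add: w_def)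
    ultimately have "(k + j) mod p \<noteq> k" "(k + j) mod p \<noteq> (k + 1) mod p" unfolding w_def by metis+
    then show ?thesis unfolding w_def by (rule LH(5)[OF idx])
  qed
  define b1 b2 where "b1 = (1 + h) * (n \<bullet> c)" and "b2 = - ((1 - h) * (Re n * Im c - Im n * Re c))"
  define N where "N j = (norm (1 - (of_real (norm c))\<^sup>2 * W j))\<^sup>2" for j
  have form: "n \<bullet> w j * N j = b1 * (1 - Re (W j)) - b2 * Im (W j)" for j
    using side_line_form[OF nc nW, of n j]
    unfolding wW[of j, symmetric] N_def b1_def b2_def h_def by simp
  have one_side: "(b1 * (1 - Re (W i)) - b2 * Im (W i)) * (b1 * (1 - Re (W j)) - b2 * Im (W j)) > 0"
    if "2 \<le> i" "i < p" "2 \<le> j" "j < p" for i j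
  proof -
    have "(n \<bullet> w i) * (n \<bullet> w j) > 0"
      using component_one_side LH(4) n(2) wH that by metis
    moreover have "N j > 0" for j
    proof -
      have "norm ((of_real (norm c))\<^sup>2 * W j) < 1"
        using nc nW by (simp add: norm_mult norm_power abs_square_less_1)
      then have "1 - (of_real (norm c))\<^sup>2 * W j \<noteq> 0"
        by (metis eq_iff_diff_eq_0 less_irrefl norm_one)
      then show ?thesis by (simp add: N_def)
    qed
    ultimately have "((n \<bullet> w i) * (n \<bullet> w j)) * (N i * N j) > 0" by simp
    then show ?thesis unfolding form[symmetric] by (simp add: mult_ac)
  qed

  \<comment> \<open>Otherwise both neighbours \<open>cis (2 * A)\<close> and
    \<open>cis (- (2 * A))\<close> of 1 among the roots of unity are vertices off the side from
    \<open>W 0\<close> to \<open>W 1\<close>, hence strictly on one side of it, against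
    \<open>chord_form_sign\<close>.\<close>
  have Re\<omega>: "Re \<omega> = cos (2 * A)"
  proof (rule ccontr)
    assume ne: "Re \<omega> \<noteq> cos (2 * A)"
    have c2A: "cos (2 * A) \<noteq> 1" using sA by (simp add: cos_double_sin)
    have ex: "\<exists>j. 2 \<le> j \<and> j < p \<and> W j = cis t" if t: "t = 2 * A \<or> t = - (2 * A)" for t
    proof -
      have e: "real p * (2 * A) = 2 * pi" using A(3) by linarith
      have "cis (2 * A) ^ p = 1" "cis (- (2 * A)) ^ p = 1"
        unfolding Complex.DeMoivre mult_minus_right e by (simp_all add: complex_eq_iff)
      then have "cis t ^ p = 1" using t by auto
      then obtain j where j: "j < p" "cis t = \<omega> ^ j"
        using roots_of_unity_powers[OF _ inj\<omega> \<omega>p] p by auto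
      have "Re (cis t) = cos (2 * A)" using t by auto
      then have "Re (\<omega> ^ j) = cos (2 * A)" using j by simp
      then have "j \<noteq> 0" "j \<noteq> 1" using ne c2A by (auto intro: gr0I)
      then have "2 \<le> j" by linarith
      then show ?thesis using j pow[of j] by auto
    qed
    obtain i where i: "2 \<le> i" "i < p" "W i = cis (2 * A)" using ex by blast
    obtain j where j: "2 \<le> j" "j < p" "W j = cis (- (2 * A))" using ex by blast
    have "\<omega> \<in> (\<lambda>l. cis (2 * pi * real l / real p)) ` {..<p}"
      using \<omega>p bij_betw_imp_surj_on[OF Complex.bij_betw_roots_unity[of p]] p by auto
    then obtain l where l: "l < p" "\<omega> = cis (2 * pi * real l / real p)" by auto
    define \<theta> where "\<theta> = real l * A"
    have \<omega>\<theta>: "\<omega> = cis (2 * \<theta>)" using l by (simp add: \<theta>_def A_def field_simps)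
    have "\<omega> \<noteq> 1" using W_ne[of 0 1] p W0 by (simp add: \<omega>_def)
    then have "l \<noteq> 0" using l(2) by (metis cis_zero div_0 mult_zero_right of_nat_0)
    then have "A \<le> \<theta>" using A(1) by (simp add: \<theta>_def)
    moreover have "\<theta> \<le> pi - A"
    proof -
      have "\<theta> + A = (real l + 1) * A" by (simp add: \<theta>_def algebra_simps)
      also have "\<dots> \<le> real p * A" using l(1) A(1) by (intro mult_right_mono) auto
      finally show ?thesis using A(3) by simp
    qed
    moreover have "b1 * (1 - cos (2 * \<theta>)) = b2 * sin (2 * \<theta>)"
      using form[of 1] nw1 pow[of 1] \<omega>\<theta> by simp
    ultimately have "(b1 * (1 - cos (2 * A)) - b2 * sin (2 * A)) * (b1 * (1 - cos (2 * A)) + b2 * sin (2 * A)) \<le> 0"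
      using chord_form_sign A(1) by blast
    then show False using one_side[OF i(1,2) j(1,2)] i(3) j(3) by simp
  qed
  have n\<omega>: "norm \<omega> = 1" using nW by (simp add: \<omega>_def)
  \<comment> \<open>The sign of \<open>Im \<omega>\<close> depends on the orientation of the
    numbering; the angle condition involves only the square.\<close>
  have Im\<omega>: "(Im \<omega>)\<^sup>2 = (sin (2 * A))\<^sup>2"
    using n\<omega> cmod_power2[of \<omega>] Re\<omega> sin_squared_eq[of "2 * A"] by simp

  \<comment> \<open>The angle condition is indexed by the vertex before the apex, so the angle at 0
    comes from index \<open>(k + (p - 1)) mod p\<close>.\<close>
  have "has_hyp_angle (w (p - 1)) (w 0) (w 1) (2 * pi / real q)"
  proof -
    have "k + (p - 1) + 1 = (k + 0) + p" "k + (p - 1) + 2 = (k + 1) + p" using p by auto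
    then have "((k + (p - 1)) mod p + 1) mod p = (k + 0) mod p"
      "((k + (p - 1)) mod p + 2) mod p = (k + 1) mod p"
      unfolding mod_add_left_eq by (simp_all only: mod_add_self2)
    then show ?thesis using ang[OF idx[of "p - 1"]] unfolding w_def by metis
  qed
  note angle = has_hyp_angle_origin[OF this[unfolded w0]]
  have "2 * B \<le> pi" using angle(2) by (simp add: B_def)
  moreover have "0 < B" using q by (simp add: B_def)
  ultimately have B: "0 < B" "B \<le> pi / 2" by linarith+
  have "W (p - 1) = cnj \<omega>"
  proof -
    have "\<omega> * \<omega> ^ (p - 1) = 1" using \<omega>p p by (simp add: power_eq_if)
    moreover have "\<omega> * cnj \<omega> = 1" using complex_norm_square[of \<omega>] n\<omega> by simp
    ultimately show ?thesis unfolding pow using n\<omega> by (metis mult_cancel_left norm_zero zero_neq_one)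
  qed
  then have "w (p - 1) = half_turn c (c * cnj \<omega>)" "w 1 = half_turn c (c * \<omega>)"
    using wW[of "p - 1"] wW[of 1] by (simp_all add: \<omega>_def)
  then have "cos (2 * B) * (((1 + h) * (1 - cos (2 * A)))\<^sup>2 + ((1 - h) * sin (2 * A))\<^sup>2) =
      ((1 + h) * (1 - cos (2 * A)))\<^sup>2 - ((1 - h) * sin (2 * A))\<^sup>2"
    using vertex_angle_at_origin[OF c0 nc n\<omega>] angle(1)
    by (simp add: inner_commute Re\<omega> Im\<omega> power_mult_distrib h_def B_def)
  from radius_of_half_angle[OF A(1,2) B h this]
  have eq: "cos (A + B) = h * cos (A - B)" .
  then show "cos (pi / p + pi / q) = (norm c)\<^sup>2 * cos (pi / p - pi / q)"
    by (simp add: A_def B_def h_def)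
  \<comment> \<open>The radius relation makes \<open>cos (A + B)\<close> positive, which yields the
    familiar condition \<open>1 / p + 1 / q < 1 / 2\<close>.\<close>
  have "cos (A - B) > 0" using A B by (intro cos_gt_zero_pi) auto
  then have "cos (A + B) > 0" using eq h by simp
  then have "A + B < pi / 2"
    using A B cos_ge_zero[of "pi - (A + B)"] unfolding cos_pi_minus by linarith
  then show "pi / p + pi / q < pi / 2" by (simp add: A_def B_def)
qed

section \<open>Existence of regular polygons\<close>

text \<open>The term \<open>r\<^sup>2\<close> cancels because
  \<open>(norm e)\<^sup>2 = 1 + r\<^sup>2\<close>, so position relative to the arc is read off from
  \<open>z \<bullet> e\<close>.\<close>

lemma orth_circle_position:
  assumes "orth_to_boundary e r"
  shows "dist e z = r \<longleftrightarrow> 2 * (z \<bullet> e) = 1 + (norm z)\<^sup>2"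
    and "r < dist e z \<longleftrightarrow> 2 * (z \<bullet> e) < 1 + (norm z)\<^sup>2"
proof -
  have r: "r > 0" using assms by (simp add: orth_to_boundary_def)
  have "(dist e z)\<^sup>2 = (norm e)\<^sup>2 + (norm z)\<^sup>2 - 2 * (z \<bullet> e)"
    unfolding dist_norm power2_norm_eq_inner by (simp add: inner_commute algebra_simps)
  then have *: "(dist e z)\<^sup>2 = r\<^sup>2 + (1 + (norm z)\<^sup>2 - 2 * (z \<bullet> e))"
    using norm_sq_orth_circle[OF assms] by simp
  have "dist e z = r \<longleftrightarrow> (dist e z)\<^sup>2 = r\<^sup>2" using r by (simp add: power2_eq_iff_nonneg)
  then show "dist e z = r \<longleftrightarrow> 2 * (z \<bullet> e) = 1 + (norm z)\<^sup>2" using * by auto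
  have "r < dist e z \<longleftrightarrow> r\<^sup>2 < (dist e z)\<^sup>2"
    using r by (metis less_imp_le power2_less_imp_less power_strict_mono zero_le_dist zero_less_numeral)
  then show "r < dist e z \<longleftrightarrow> 2 * (z \<bullet> e) < 1 + (norm z)\<^sup>2" using * by auto
qed

text \<open>The outer region is star-shaped about 0, hence connected. The component of 0 is no
  larger, since its image under \<open>dist e\<close> is an interval that misses
  \<open>r\<close>.\<close>

lemma outer_component_arc_line:
  assumes "orth_to_boundary e r"
  shows "disc - cball e r \<in> components (disc - arc_line e r)"
proof -
  let ?S = "disc - arc_line e r" and ?H = "disc - cball e r"
  have mem: "z \<in> ?H \<longleftrightarrow> norm z < 1 \<and> 2 * (z \<bullet> e) < 1 + (norm z)\<^sup>2" for z
    using orth_circle_position(2)[OF assms, of z] by (auto simp: not_le)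
  have "t *\<^sub>R z \<in> ?H" if z: "z \<in> ?H" and t: "0 \<le> t" "t \<le> 1" for z t
  proof -
    define N where "N = (norm z)\<^sup>2"
    have nz: "norm z < 1" "2 * (z \<bullet> e) < 1 + N" using z unfolding mem N_def by auto
    have N: "0 \<le> N" "N < 1" using nz(1) by (auto simp: N_def abs_square_less_1)
    have "norm (t *\<^sub>R z) < 1"
      using t nz(1) by (simp add: mult_le_one order_le_less_trans[OF mult_left_le_one_le])
    moreover have "t * (2 * (z \<bullet> e)) < 1 + t\<^sup>2 * N"
    proof (cases "t = 0")
      case False
      have "t * (2 * (z \<bullet> e)) < t * (1 + N)" using nz(2) False t by simp
      \<comment> \<open>Expanding this product gives exactly the bound needed to shrink towards
        0.\<close>
      also have "(1 - t) * (1 - t * N) \<ge> 0" using t N by (simp add: mult_le_one)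
      then have "t * (1 + N) \<le> 1 + t\<^sup>2 * N" by (simp add: power2_eq_square algebra_simps)
      finally show ?thesis .
    qed simp
    ultimately show ?thesis unfolding mem by (simp add: N_def power_mult_distrib)
  qed
  moreover have "0 \<in> ?H" unfolding mem by simp
  ultimately have "starlike ?H"
    unfolding starlike_def by (intro bexI[of _ 0]) (auto simp: in_segment)
  then have conn: "connected ?H" by (rule starlike_imp_connected)
  have 0: "0 \<in> ?S" using \<open>0 \<in> ?H\<close> by (auto simp: arc_line_def)
  have "connected_component_set ?S 0 = ?H"
  proof
    show "?H \<subseteq> connected_component_set ?S 0"
      using \<open>0 \<in> ?H\<close> conn by (intro connected_component_maximal) (auto simp: arc_line_def)
    let ?C = "connected_component_set ?S 0"
    have sub: "?C \<subseteq> ?S" by (rule connected_component_subset)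
    have "connected (dist e ` ?C)"
      by (intro connected_continuous_image continuous_intros connected_connected_component)
    then have int: "is_interval (dist e ` ?C)" by (simp add: is_interval_connected_1)
    have "0 \<in> ?C" using 0 by simp
    show "?C \<subseteq> ?H"
    proof
      fix z assume z: "z \<in> ?C"
      have "r < dist e z"
      proof (rule ccontr)
        assume "\<not> r < dist e z"
        then have "dist e z \<le> r" by simp
        moreover have "r \<le> dist e 0" using \<open>0 \<in> ?H\<close> by auto
        moreover have "dist e z \<in> dist e ` ?C" "dist e 0 \<in> dist e ` ?C"
          using z \<open>0 \<in> ?C\<close> by blast+
        ultimately have "r \<in> dist e ` ?C"
          using mem_is_interval_1_I[OF int] by blast
        then show False using sub by (auto simp: arc_line_def)
      qed
      then show "z \<in> ?H" using z sub by auto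
    qed
  qed
  then show ?thesis using 0 by (metis componentsI)
qed

lemma inner_cis: "cis a \<bullet> cis b = cos (a - b)"
  by (simp add: inner_complex_def cos_diff)

text \<open>The sign \<open>\<sigma>\<close> treats both sides at a vertex at once. The first
  equation in \<open>d\<close> puts both endpoints on the arc, whose centre has the argument halfway
  between them; the second makes the tangent deviate by \<open>B\<close> from the inward
  radius.\<close>

lemma unit_tangent_side:
  fixes A B \<rho> d \<tau> \<sigma> :: real
  assumes "\<sigma> = 1 \<or> \<sigma> = -1" "0 < A" "A < pi / 2" "0 < B" "A + B < pi / 2" "0 < \<rho>" "\<rho> < 1"
    and d: "2 * \<rho> * d * cos A = 1 + \<rho>\<^sup>2" "\<rho> * cos B = d * cos (A + B)"
    and orth: "orth_to_boundary (of_real d * cis (\<tau> + \<sigma> * A)) r"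
  shows "unit_tangent (of_real \<rho> * cis \<tau>) (of_real \<rho> * cis (\<tau> + 2 * \<sigma> * A)) (- cis (\<tau> - \<sigma> * B))"
proof -
  define e where "e = of_real d * cis (\<tau> + \<sigma> * A)"
  define z where "z = of_real \<rho> * cis \<tau>"
  define w where "w = of_real \<rho> * cis (\<tau> + 2 * \<sigma> * A)"
  define u where "u = - cis (\<tau> - \<sigma> * B)"
  have ie: "(of_real a * cis s) \<bullet> (of_real b * cis t) = a * b * cos (s - t)" for a b s t
    using inner_cis[of s t] by (simp flip: scaleR_conv_of_real)
  have iu: "(of_real a * cis s) \<bullet> u = - (a * cos (s - (\<tau> - \<sigma> * B)))" for a s
    using inner_cis[of s "\<tau> - \<sigma> * B"] by (simp add: u_def flip: scaleR_conv_of_real)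
  have \<sigma>: "cos (\<sigma> * x) = cos x" "cos (- (\<sigma> * x)) = cos x" for x using assms(1) by auto
  have "z \<bullet> e = \<rho> * d * cos A" "w \<bullet> e = \<rho> * d * cos A"
    using \<sigma>[of A] unfolding z_def w_def e_def ie by (simp_all add: algebra_simps)
  moreover have nzw: "norm z = \<rho>" "norm w = \<rho>" using assms by (simp_all add: z_def w_def norm_mult)
  ultimately have L: "z \<in> arc_line e r" "w \<in> arc_line e r"
    using orth_circle_position(1)[OF orth] d(1) assms(7) by (auto simp: arc_line_def e_def)
  have "(z - e) \<bullet> u = d * cos (\<sigma> * (A + B)) - \<rho> * cos (\<sigma> * B)"
    unfolding inner_diff_left z_def e_def iu by (simp add: algebra_simps)
  then have "orthogonal (z - e) u" using d(2) by (simp add: \<sigma> orthogonal_def)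
  moreover have "u \<bullet> (w - z) > 0"
  proof -
    have "(w - z) \<bullet> u = \<rho> * (cos (\<sigma> * B) - cos (\<sigma> * (2 * A + B)))"
      unfolding inner_diff_left z_def w_def iu by (simp add: algebra_simps)
    also have "\<dots> > 0"
      unfolding \<sigma> using assms by (intro mult_pos_pos) (auto intro!: cos_monotone_0_pi)
    finally show ?thesis by (simp add: inner_commute)
  qed
  moreover have "norm u = 1" by (simp add: u_def)
  ultimately show ?thesis
    using orth L unfolding unit_tangent_def hyp_line_def line_tangent_def z_def w_def u_def e_def
    by blast
qed

text \<open>With \<open>\<delta> = j - i\<close> the difference of the cosines is
  \<open>2 * sin (\<delta> * A) * sin ((\<delta> - 1) * A)\<close>. It vanishes at the two endpoints
  of the side, and for every other vertex the two sines have the same sign.\<close>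

lemma cos_side_less:
  fixes i j p :: nat
  assumes "i < p" "j < p" "j \<noteq> i" "j \<noteq> (i + 1) mod p" "A = pi / p"
  shows "cos ((2 * (real j - real i) - 1) * A) < cos A"
proof -
  define \<delta> where "\<delta> = real j - real i"
  have pA: "real p * A = pi" "A > 0" using assms by auto
  have pos: "sin (x * A) > 0" if "0 < x" "x < real p" for x
    using that pA by (intro sin_gt_zero) (auto simp flip: pA(1))
  have "cos A - cos ((2 * \<delta> - 1) * A) = 2 * sin (\<delta> * A) * sin ((\<delta> - 1) * A)"
  proof -
    have "(A + (2 * \<delta> - 1) * A) / 2 = \<delta> * A" "((2 * \<delta> - 1) * A - A) / 2 = (\<delta> - 1) * A"
      by (simp_all add: field_simps)
    then show ?thesis using cos_diff_cos[of A "(2 * \<delta> - 1) * A"] by simp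
  qed
  also have "\<dots> > 0"
  proof (cases "i < j")
    case True
    have "j \<noteq> i + 1" using assms by auto
    then have "1 < \<delta>" "\<delta> < real p" using True assms(2) by (auto simp: \<delta>_def)
    then show ?thesis using pos[of \<delta>] pos[of "\<delta> - 1"] by simp
  next
    case False
    \<comment> \<open>This covers the closing side, where \<open>i = p - 1\<close> and the excluded
      endpoint is \<open>j = 0\<close>.\<close>
    have "i + 1 \<noteq> j + p" using assms by (cases "i + 1 = p") auto
    then have "0 < - \<delta>" "1 - \<delta> < real p" using False assms(1-3) by (auto simp: \<delta>_def)
    then have "sin (- \<delta> * A) > 0" "sin ((1 - \<delta>) * A) > 0"
      by - (rule pos; linarith)+
    moreover have "(1 - \<delta>) * A = - ((\<delta> - 1) * A)" by (simp add: algebra_simps)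
    ultimately have "sin (\<delta> * A) < 0" "sin ((\<delta> - 1) * A) < 0" by simp_all
    then show ?thesis by (simp add: mult_neg_neg)
  qed
  finally show ?thesis by (simp add: \<delta>_def)
qed

text \<open>The polygon is built about the centre 0, where symmetry makes all sides and angles
  alike; its vertices are not placed at the origin.\<close>

lemma regular_hyp_polygon_exists:
  fixes p q :: nat
  assumes "p \<ge> 3" "q > 0" "pi / p + pi / q < pi / 2"
  shows "\<exists>v. regular_hyp_polygon p q v"
proof -
  define A B where "A = pi / p" and "B = pi / q"
  have A: "0 < A" "A < pi / 2" "real p * A = pi" using assms(1) by (simp_all add: A_def field_simps)
  have B: "0 < B" "A + B < pi / 2" using assms by (simp_all add: A_def B_def)
  have pos: "cos (A + B) > 0" "cos (A - B) > 0" "cos A > 0" "cos B > 0" "sin A > 0" "sin B > 0"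
    using A B by (auto intro!: cos_gt_zero_pi sin_gt_zero)
  \<comment> \<open>\<open>\<rho>\<close> solves the radius relation; \<open>d\<close> below is then
    forced by the vertices lying on the side arcs, and \<open>r\<close> by orthogonality to the
    boundary.\<close>
  define \<rho> where "\<rho> = sqrt (cos (A + B) / cos (A - B))"
  have \<rho>2: "\<rho>\<^sup>2 * cos (A - B) = cos (A + B)" using pos by (simp add: \<rho>_def)
  have "cos (A + B) < cos (A - B)" using pos by (simp add: cos_add cos_diff)
  then have \<rho>: "0 < \<rho>" "\<rho> < 1" using pos by (simp_all add: \<rho>_def)
  define d where "d = (1 + \<rho>\<^sup>2) / (2 * \<rho> * cos A)"
  have d: "2 * \<rho> * d * cos A = 1 + \<rho>\<^sup>2" using \<rho> pos by (simp add: d_def)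
  have "2 * \<rho> * cos A * (\<rho> * cos B) = 2 * \<rho> * cos A * (d * cos (A + B))"
    using d \<rho>2 unfolding cos_add cos_diff by algebra
  then have d': "\<rho> * cos B = d * cos (A + B)" using \<rho> pos by simp
  have d1: "d > 1"
  proof -
    have "cos A < 1" using cos_monotone_0_pi[of 0 A] A by simp
    then have "2 * \<rho> * cos A < 2 * \<rho> * 1" using \<rho> by (intro mult_strict_left_mono) auto
    also have "\<dots> \<le> 1 + \<rho>\<^sup>2" using zero_le_power2[of "1 - \<rho>"] by (simp add: power2_diff)
    finally show ?thesis using \<rho> pos by (simp add: d_def)
  qed
  define r where "r = sqrt (d\<^sup>2 - 1)"
  have d2: "d\<^sup>2 > 1" using d1 by simp
  have orth: "orth_to_boundary (of_real d * cis t) r" for t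
    using d2 d1 by (intro orth_to_boundaryI) (auto simp: r_def norm_mult)

  define v where "v j = of_real \<rho> * cis (2 * real j * A)" for j :: nat
  have v_mod: "v (j mod p) = v j" for j
  proof -
    have "real j = real p * real (j div p) + real (j mod p)"
      by (metis mult_div_mod_eq of_nat_add of_nat_mult)
    then have "2 * real j * A = 2 * real (j mod p) * A + 2 * (real p * A) * real (j div p)"
      by (simp add: algebra_simps)
    then have "2 * real j * A = 2 * real (j mod p) * A + 2 * pi * real (j div p)"
      using A(3) by simp
    then have "cis (2 * real j * A) = cis (2 * real (j mod p) * A) * cis (2 * pi * real (j div p))"
      by (simp only: cis_mult)
    moreover have "cis (2 * pi * real (j div p)) = 1"
      by (metis cis_multiple_2pi Ints_of_nat)
    ultimately show ?thesis by (simp add: v_def)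
  qed
  have nv: "norm (v j) = \<rho>" for j using \<rho> by (simp add: v_def norm_mult)
  \<comment> \<open>The centre of the arc carrying side \<open>i\<close> has the argument halfway
    between the two vertices.\<close>
  define e where "e i = of_real d * cis ((2 * real i + 1) * A)" for i :: nat
  have ie: "v j \<bullet> e i = \<rho> * d * cos ((2 * (real j - real i) - 1) * A)" for i j
    using inner_cis[of "2 * real j * A" "(2 * real i + 1) * A"]
    by (simp add: v_def e_def algebra_simps flip: scaleR_conv_of_real)
  have "convex_hyp_polygon p v"
    unfolding convex_hyp_polygon_def
  proof (intro conjI allI impI)
    show "p \<ge> 3" by fact
    show "v ` {..<p} \<subseteq> disc" using nv \<rho> by auto
    have "inj_on (\<lambda>k. cis (2 * pi * real k / real p)) {..<p}"
      using bij_betw_imp_inj_on[OF Complex.bij_betw_roots_unity[of p]] assms(1) by simp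
    then show "inj_on v {..<p}" using \<rho> by (simp add: v_def A_def inj_on_def algebra_simps)
    fix i assume i: "i < p"
    show "\<exists>L H. hyp_line L \<and> v i \<in> L \<and> v ((i + 1) mod p) \<in> L \<and> H \<in> components (disc - L) \<and>
        (\<forall>j<p. j \<noteq> i \<and> j \<noteq> (i + 1) mod p \<longrightarrow> v j \<in> H)"
    proof (intro exI conjI allI impI)
      note o = orth[of "(2 * real i + 1) * A", folded e_def]
      show "hyp_line (arc_line (e i) r)" using o by (auto simp: hyp_line_def)
      show "disc - cball (e i) r \<in> components (disc - arc_line (e i) r)"
        by (rule outer_component_arc_line[OF o])
      have "v i \<bullet> e i = \<rho> * d * cos A" "v (i + 1) \<bullet> e i = \<rho> * d * cos A"
        unfolding ie by simp_all
      then show "v i \<in> arc_line (e i) r" "v ((i + 1) mod p) \<in> arc_line (e i) r"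
        unfolding v_mod using orth_circle_position(1)[OF o] nv \<rho> d by (auto simp: arc_line_def)
      fix j assume j: "j < p" "j \<noteq> i \<and> j \<noteq> (i + 1) mod p"
      have "v j \<bullet> e i < \<rho> * d * cos A"
        unfolding ie using cos_side_less[OF i, of j A] j \<rho> d1 A_def by simp
      then have "r < dist (e i) (v j)"
        unfolding orth_circle_position(2)[OF o] nv using d by linarith
      then show "v j \<in> disc - cball (e i) r" using nv \<rho> by auto
    qed
  qed
  moreover have "hdist (v i) (v ((i + 1) mod p)) = hdist (v 0) (v 1)" for i
  proof -
    have "v (i + 1) - v i = cis (2 * real i * A) * (v 1 - v 0)"
      by (simp add: v_def algebra_simps cis_mult)
    then have "norm (v (i + 1) - v i) = norm (v 1 - v 0)"
      by (simp only: norm_mult norm_cis mult_1_left)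
    then have "dist (v i) (v (i + 1)) = dist (v 0) (v 1)"
      by (metis dist_commute dist_norm)
    then show ?thesis unfolding v_mod hdist_def nv by simp
  qed
  moreover have "has_hyp_angle (v i) (v ((i + 1) mod p)) (v ((i + 2) mod p)) (2 * pi / real q)" for i
  proof -
    define \<tau> where "\<tau> = 2 * real (i + 1) * A"
    have "unit_tangent (v (i + 1)) (v i) (- cis (\<tau> + B))"
      using unit_tangent_side[of "-1" A B \<rho> d \<tau> r] A B \<rho> d d' orth
      by (simp add: v_def \<tau>_def algebra_simps)
    moreover have "unit_tangent (v (i + 1)) (v (i + 2)) (- cis (\<tau> - B))"
      using unit_tangent_side[of 1 A B \<rho> d \<tau> r] A B \<rho> d d' orth
      by (simp add: v_def \<tau>_def algebra_simps)
    moreover have "2 * pi / real q = arccos ((- cis (\<tau> + B)) \<bullet> (- cis (\<tau> - B)))"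
    proof -
      \<comment> \<open>\<open>arccos\<close> inverts \<open>cos\<close> only on the interval from 0
        to \<open>pi\<close>.\<close>
      have "2 * B \<le> pi" using A B by linarith
      then show ?thesis using B arccos_cos[of "2 * B"] by (simp add: inner_cis B_def)
    qed
    ultimately show ?thesis unfolding has_hyp_angle_def v_mod by blast
  qed
  ultimately show ?thesis using assms(2) unfolding regular_hyp_polygon_def by blast
qed

section \<open>Closed formulas and limits\<close>

text \<open>Since \<open>(cos B)\<^sup>2 - (sin A)\<^sup>2 = cos (A + B) * cos (A - B)\<close>, the
  radius relation turns the radicand into the square of \<open>norm c * cos (A - B)\<close>, and the
  right-hand sides reduce to \<open>norm c\<close> and
  \<open>norm c / (1 + (norm c)\<^sup>2)\<close>.\<close>

lemma positioned_polygon_distances: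
  assumes "positioned_polygon p q v \<Gamma> c m"
  shows "dist 0 c = cos (pi / q + pi / p) / sqrt ((cos (pi / q))\<^sup>2 - (sin (pi / p))\<^sup>2)"
    and "dist 0 m = cos (pi / q + pi / p) * sqrt ((cos (pi / q))\<^sup>2 - (sin (pi / p))\<^sup>2) /
      ((cos (pi / q))\<^sup>2 - (sin (pi / p))\<^sup>2 + (cos (pi / q + pi / p))\<^sup>2)"
proof -
  note P = positioned_polygon_radius[OF assms]
  define A B h where "A = pi / p" and "B = pi / q" and "h = norm c"
  have AB: "0 < A" "0 < B" "A + B < pi / 2" using P by (simp_all add: A_def B_def)
  define D where "D = cos (A - B)"
  have D: "D > 0" unfolding D_def using AB by (intro cos_gt_zero_pi) auto
  have h: "h > 0" using P(1) by (simp add: h_def)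
  have C: "cos (B + A) = h\<^sup>2 * D" using P(5) by (simp add: A_def B_def h_def D_def add.commute)
  have "(cos B)\<^sup>2 - (sin A)\<^sup>2 = cos (B + A) * cos (A - B)"
    using sin_cos_squared_add[of A] sin_cos_squared_add[of B] unfolding cos_add cos_diff by algebra
  then have S: "(cos B)\<^sup>2 - (sin A)\<^sup>2 = (h * D)\<^sup>2" using C by (simp add: D_def power2_eq_square)
  have R: "sqrt ((h * D)\<^sup>2) = h * D" using h D by simp
  show "dist 0 c = cos (pi / q + pi / p) / sqrt ((cos (pi / q))\<^sup>2 - (sin (pi / p))\<^sup>2)"
    unfolding A_def[symmetric] B_def[symmetric] S C R using h D
    by (simp add: h_def power2_eq_square)
  have "1 + h\<^sup>2 > 0" by (simp add: add_pos_nonneg)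
  then have "h / (1 + h\<^sup>2) = (h\<^sup>2 * D) * (h * D) / ((h * D)\<^sup>2 * (1 + h\<^sup>2))"
    using h D by (simp add: power2_eq_square)
  also have "(h * D)\<^sup>2 * (1 + h\<^sup>2) = (h * D)\<^sup>2 + (h\<^sup>2 * D)\<^sup>2" by algebra
  finally show "dist 0 m = cos (pi / q + pi / p) * sqrt ((cos (pi / q))\<^sup>2 - (sin (pi / p))\<^sup>2) /
      ((cos (pi / q))\<^sup>2 - (sin (pi / p))\<^sup>2 + (cos (pi / q + pi / p))\<^sup>2)"
    unfolding A_def[symmetric] B_def[symmetric] S C R using P(6) by (simp add: h_def)
qed

theorem theorem2:
  "(\<forall>(p::nat) (q::nat) (P :: nat \<Rightarrow> complex) \<Gamma> c m. positioned_polygon p q P \<Gamma> c m \<longrightarrow>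
      dist 0 c = cos (pi / real q + pi / real p) /
                 sqrt ((cos (pi / real q))\<^sup>2 - (sin (pi / real p))\<^sup>2) \<and>
      dist 0 m = cos (pi / real q + pi / real p) *
                 sqrt ((cos (pi / real q))\<^sup>2 - (sin (pi / real p))\<^sup>2) /
                 ((cos (pi / real q))\<^sup>2 - (sin (pi / real p))\<^sup>2
                   + (cos (pi / real q + pi / real p))\<^sup>2)) \<and>
   (\<forall>(q::nat) (P :: nat \<Rightarrow> nat \<Rightarrow> complex) \<Gamma> c m.
      (\<exists>p v. regular_hyp_polygon p q v) \<longrightarrow>
      (\<forall>p. (\<exists>v. regular_hyp_polygon p q v) \<longrightarrow>
           positioned_polygon p q (P p) (\<Gamma> p) (c p) (m p)) \<longrightarrow>
      ((\<lambda>p. dist 0 (c p)) \<longlonglongrightarrow> 1) \<and> ((\<lambda>p. dist 0 (m p)) \<longlonglongrightarrow> 1 / 2))"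
proof (intro conjI[OF _ allI[OF allI[OF allI[OF allI[OF allI[OF impI[OF impI]]]]]]] allI impI)
  fix p q :: nat and P \<Gamma> c m assume "positioned_polygon p q P \<Gamma> c m"
  from positioned_polygon_distances[OF this]
  show "dist 0 c = cos (pi / real q + pi / real p) /
                 sqrt ((cos (pi / real q))\<^sup>2 - (sin (pi / real p))\<^sup>2) \<and>
      dist 0 m = cos (pi / real q + pi / real p) *
                 sqrt ((cos (pi / real q))\<^sup>2 - (sin (pi / real p))\<^sup>2) /
                 ((cos (pi / real q))\<^sup>2 - (sin (pi / real p))\<^sup>2
                   + (cos (pi / real q + pi / real p))\<^sup>2)" by blast
next
  fix q :: nat and P :: "nat \<Rightarrow> nat \<Rightarrow> complex" and \<Gamma> c m
  assume "\<exists>p v. regular_hyp_polygon p q v"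
    and pos: "\<forall>p. (\<exists>v. regular_hyp_polygon p q v) \<longrightarrow>
           positioned_polygon p q (P p) (\<Gamma> p) (c p) (m p)"
  then obtain p0 where "positioned_polygon p0 q (P p0) (\<Gamma> p0) (c p0) (m p0)" by blast
  note P0 = positioned_polygon_radius[OF this]
  define B where "B = pi / q"
  have "pi / p0 > 0" using P0(2) by simp
  \<comment> \<open>A single polygon forces the strict bound on \<open>B\<close>; it keeps the
    limits of the denominators away from 0.\<close>
  then have B: "0 < B" "B < pi / 2" using P0(3,4) unfolding B_def by (simp, linarith)
  then have cB: "cos B > 0" by (simp add: cos_gt_zero)
  have lim: "(\<lambda>p. pi / real p) \<longlonglongrightarrow> 0" by (rule lim_const_over_n)
  have "\<forall>\<^sub>F p in sequentially. pi / real p < pi / 2 - B"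
    using order_tendstoD(2)[OF lim] B by simp
  \<comment> \<open>For large \<open>p\<close> a regular polygon exists, so the hypothesis on the
    chosen family takes effect.\<close>
  then have ev: "\<forall>\<^sub>F p in sequentially. positioned_polygon p q (P p) (\<Gamma> p) (c p) (m p)"
    using eventually_ge_at_top[of 3]
  proof eventually_elim
    case (elim p)
    then have "pi / p + pi / q < pi / 2" unfolding B_def by linarith
    then show ?case using pos regular_hyp_polygon_exists[OF elim(2) P0(3)] by blast
  qed
  define S where "S p = (cos B)\<^sup>2 - (sin (pi / real p))\<^sup>2" for p
  have S: "S \<longlonglongrightarrow> (cos B)\<^sup>2 - (sin 0)\<^sup>2"
    unfolding S_def by (intro tendsto_intros lim)
  have C: "(\<lambda>p. cos (B + pi / real p)) \<longlonglongrightarrow> cos (B + 0)"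
    by (intro tendsto_intros lim)
  have "(\<lambda>p. cos (B + pi / real p) / sqrt (S p)) \<longlonglongrightarrow> cos (B + 0) / sqrt ((cos B)\<^sup>2 - (sin 0)\<^sup>2)"
    using cB by (intro tendsto_divide tendsto_real_sqrt S C) auto
  moreover have "\<forall>\<^sub>F p in sequentially. dist 0 (c p) = cos (B + pi / real p) / sqrt (S p)"
    using ev by eventually_elim (unfold B_def S_def, rule positioned_polygon_distances(1))
  moreover have "(\<lambda>p. cos (B + pi / real p) * sqrt (S p) / (S p + (cos (B + pi / real p))\<^sup>2)) \<longlonglongrightarrow>
    cos (B + 0) * sqrt ((cos B)\<^sup>2 - (sin 0)\<^sup>2) / ((cos B)\<^sup>2 - (sin 0)\<^sup>2 + (cos (B + 0))\<^sup>2)"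
    using cB by (intro tendsto_intros S C) auto
  moreover have "\<forall>\<^sub>F p in sequentially. dist 0 (m p) =
      cos (B + pi / real p) * sqrt (S p) / (S p + (cos (B + pi / real p))\<^sup>2)"
    using ev by eventually_elim (unfold B_def S_def, rule positioned_polygon_distances(2))
  \<comment> \<open>As \<open>cos B > 0\<close>, the limit values simplify to
    \<open>cos B / cos B\<close> and \<open>(cos B)\<^sup>2 / (2 * (cos B)\<^sup>2)\<close>.\<close>
  ultimately show "((\<lambda>p. dist 0 (c p)) \<longlonglongrightarrow> 1) \<and> ((\<lambda>p. dist 0 (m p)) \<longlonglongrightarrow> 1 / 2)"
    using cB by (simp add: tendsto_cong power2_eq_square)
qed

end
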